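(* Let $R$ be a $G$-graded ring. Then $\mathrm{Spec}_G(R)$ with the Zariski topology is a Noetherian topological space if and only if every graded prime ideal of $R$ is an $RFG_g$-ideal.
   Context: $G$ is an abelian group with identity $e$; all rings are commutative with unity $1$. A $G$-graded ring is a ring $R=\bigoplus_{g\in G}R_g$ with additive subgroups $R_g$ satisfying $R_gR_h\subseteq R_{gh}$; $h(R)=\bigcup_{g}R_g$. An ideal $I$ of $R$ is graded ($I\lhd_G R$) if $I=\bigoplus_g (I\cap R_g)$. A graded prime ideal is a proper graded ideal $p$ such that for $a,b\in h(R)$, $ab\in p$ implies $a\in p$ or $b\in p$; $\mathrm{Spec}_G(R)$ is the set of all graded prime ideals. For $J\lhd_G R$ put $V_G^R(J)=\{p\in \mathrm{Spec}_G(R): J\subseteq p\}$; these are the closed sets of the Zariski topology on $\mathrm{Spec}_G(R)$. The graded radical $Gr(I)$ of $I\lhd_G R$ is the set of all $a=\sum_g a_g\in R$ (with $a_g\in R_g$) such that for each $g$ there is $n_g>0$ with $a_g^{n_g}\in I$. A graded ideal $J$ is graded finitely generated if $J=Rr_1+\dots+Rr_n$ for some $r_1,\dots,r_n\in J\cap h(R)$. A graded ideal $I$ is an $RFG_g$-ideal if $Gr(I)=Gr(J)$ for some graded finitely generated ideal $J$ of $R$. A topological space is Noetherian if its closed sets satisfy the descending chain condition. *)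

theory Defs
  imports "HOL-Analysis.Abstract_Topology" "HOL-Algebra.Ideal"
begin

section \<open>Internal direct sums\<close>

text \<open>The families \<open>(x\<^sub>i)\<^sub>i\<^sub>\<in>\<^sub>I\<close> with \<open>x\<^sub>i \<in> A i\<close> and almost all \<open>x\<^sub>i\<close> zero.\<close>

definition finsupp_families :: "('a, 'm) ring_scheme \<Rightarrow> 'i set \<Rightarrow> ('i \<Rightarrow> 'a set) \<Rightarrow> ('i \<Rightarrow> 'a) set"
  where "finsupp_families R I A = {x \<in> PiE I A. finite {i \<in> I. x i \<noteq> \<zero>\<^bsub>R\<^esub>}}"

text \<open>The sum is taken over the support because \<^const>\<open>finsum\<close> over an infinite index set is zero
  by convention.\<close>

definition family_sum :: "('a, 'm) ring_scheme \<Rightarrow> 'i set \<Rightarrow> ('i \<Rightarrow> 'a) \<Rightarrow> 'a"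
  where "family_sum R I x = (\<Oplus>\<^bsub>R\<^esub>i\<in>{i \<in> I. x i \<noteq> \<zero>\<^bsub>R\<^esub>}. x i)"

definition internal_direct_sum ::
    "('a, 'm) ring_scheme \<Rightarrow> 'i set \<Rightarrow> ('i \<Rightarrow> 'a set) \<Rightarrow> 'a set \<Rightarrow> bool"
  where "internal_direct_sum R I A M \<longleftrightarrow>
    (\<forall>i\<in>I. additive_subgroup (A i) R) \<and>
    bij_betw (family_sum R I) (finsupp_families R I A) M"

section \<open>Graded rings and graded ideals\<close>

locale graded_cring = G: comm_group G + R: cring R
  for G :: "('g, 'n) monoid_scheme" and R :: "('a, 'm) ring_scheme" and A :: "'g \<Rightarrow> 'a set" +
  assumes direct_sum: "internal_direct_sum R (carrier G) A (carrier R)"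
    and mult_mem: "\<lbrakk>g \<in> carrier G; h \<in> carrier G; a \<in> A g; b \<in> A h\<rbrakk> \<Longrightarrow> a \<otimes>\<^bsub>R\<^esub> b \<in> A (g \<otimes>\<^bsub>G\<^esub> h)"

definition homogeneous :: "('g, 'n) monoid_scheme \<Rightarrow> ('g \<Rightarrow> 'a set) \<Rightarrow> 'a set"
  where "homogeneous G A = (\<Union>g\<in>carrier G. A g)"

definition graded_ideal ::
    "('g, 'n) monoid_scheme \<Rightarrow> ('a, 'm) ring_scheme \<Rightarrow> ('g \<Rightarrow> 'a set) \<Rightarrow> 'a set \<Rightarrow> bool"
  where "graded_ideal G R A I \<longleftrightarrow>
    ideal I R \<and> internal_direct_sum R (carrier G) (\<lambda>g. I \<inter> A g) I"

definition graded_prime_ideal ::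
    "('g, 'n) monoid_scheme \<Rightarrow> ('a, 'm) ring_scheme \<Rightarrow> ('g \<Rightarrow> 'a set) \<Rightarrow> 'a set \<Rightarrow> bool"
  where "graded_prime_ideal G R A p \<longleftrightarrow>
    graded_ideal G R A p \<and> p \<noteq> carrier R \<and>
    (\<forall>a\<in>homogeneous G A. \<forall>b\<in>homogeneous G A. a \<otimes>\<^bsub>R\<^esub> b \<in> p \<longrightarrow> a \<in> p \<or> b \<in> p)"

definition graded_radical ::
    "('g, 'n) monoid_scheme \<Rightarrow> ('a, 'm) ring_scheme \<Rightarrow> ('g \<Rightarrow> 'a set) \<Rightarrow> 'a set \<Rightarrow> 'a set"
  where "graded_radical G R A I =
    {family_sum R (carrier G) a | a. a \<in> finsupp_families R (carrier G) A \<and>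
      (\<forall>g\<in>carrier G. \<exists>n::nat. n > 0 \<and> a g [^]\<^bsub>R\<^esub> n \<in> I)}"

definition graded_finitely_generated ::
    "('g, 'n) monoid_scheme \<Rightarrow> ('a, 'm) ring_scheme \<Rightarrow> ('g \<Rightarrow> 'a set) \<Rightarrow> 'a set \<Rightarrow> bool"
  where "graded_finitely_generated G R A J \<longleftrightarrow>
    (\<exists>(n::nat) r. (\<forall>i<n. r i \<in> J \<inter> homogeneous G A) \<and>
      J = {\<Oplus>\<^bsub>R\<^esub>i\<in>{..<n}. s i \<otimes>\<^bsub>R\<^esub> r i | s. s \<in> {..<n} \<rightarrow> carrier R})"

definition RFG_ideal ::
    "('g, 'n) monoid_scheme \<Rightarrow> ('a, 'm) ring_scheme \<Rightarrow> ('g \<Rightarrow> 'a set) \<Rightarrow> 'a set \<Rightarrow> bool"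
  where "RFG_ideal G R A I \<longleftrightarrow>
    graded_ideal G R A I \<and>
    (\<exists>J. graded_ideal G R A J \<and> graded_finitely_generated G R A J \<and>
      graded_radical G R A I = graded_radical G R A J)"

section \<open>The graded spectrum\<close>

definition graded_spectrum ::
    "('g, 'n) monoid_scheme \<Rightarrow> ('a, 'm) ring_scheme \<Rightarrow> ('g \<Rightarrow> 'a set) \<Rightarrow> 'a set set"
  where "graded_spectrum G R A = {p. graded_prime_ideal G R A p}"

definition graded_variety ::
    "('g, 'n) monoid_scheme \<Rightarrow> ('a, 'm) ring_scheme \<Rightarrow> ('g \<Rightarrow> 'a set) \<Rightarrow> 'a set \<Rightarrow> 'a set set"
  where "graded_variety G R A J = {p \<in> graded_spectrum G R A. J \<subseteq> p}"

text \<open>The open sets are the complements of the varieties. That these form a topology, so that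
  the use of \<^const>\<open>topology\<close> is justified, is lemma \<open>istopology_zariski\<close> below.\<close>

definition zariski_topology ::
    "('g, 'n) monoid_scheme \<Rightarrow> ('a, 'm) ring_scheme \<Rightarrow> ('g \<Rightarrow> 'a set) \<Rightarrow> 'a set topology"
  where "zariski_topology G R A =
    topology (\<lambda>U. \<exists>J. graded_ideal G R A J \<and> U = graded_spectrum G R A - graded_variety G R A J)"

definition noetherian_space :: "'a topology \<Rightarrow> bool"
  where "noetherian_space X \<longleftrightarrow>
    (\<forall>C :: nat \<Rightarrow> 'a set. (\<forall>n. closedin X (C n)) \<and> (\<forall>n. C (Suc n) \<subseteq> C n) \<longrightarrow>
      (\<exists>n. \<forall>m\<ge>n. C m = C n))"

context graded_cring
begin

lemma family_sum_mem_ideal: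
  assumes "ideal I R" "\<And>g. g \<in> carrier G \<Longrightarrow> x g \<in> I"
  shows "family_sum R (carrier G) x \<in> I"
proof -
  interpret I: ideal I R by fact
  have "(\<Oplus>\<^bsub>R\<^esub>i\<in>S. x i) \<in> I" if "S \<subseteq> carrier G" for S
  proof (cases "finite S")
    case True
    then show ?thesis using that
    proof (induction S)
      case empty
      then show ?case by simp
    next
      case (insert g S)
      have "x \<in> insert g S \<rightarrow> carrier R"
        using insert.prems assms(2) I.a_subset by blast
      then show ?case using insert assms(2) by (simp add: R.finsum_insert)
    qed
  next
    case False
    then show ?thesis by (simp add: R.finsum_infinite)
  qed
  from this[of "{g \<in> carrier G. x g \<noteq> \<zero>\<^bsub>R\<^esub>}"] show ?thesis by (simp add: family_sum_def)
qed

lemma finsupp_families_Int_subset: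
  "finsupp_families R (carrier G) (\<lambda>g. I \<inter> A g) \<subseteq> finsupp_families R (carrier G) A"
  unfolding finsupp_families_def by (auto simp: PiE_iff)

lemma family_sum_bij:
  "bij_betw (family_sum R (carrier G)) (finsupp_families R (carrier G) A) (carrier R)"
  using direct_sum by (simp add: internal_direct_sum_def)

lemma graded_ideal_component:
  assumes "graded_ideal G R A I" "x \<in> finsupp_families R (carrier G) A"
    and "family_sum R (carrier G) x \<in> I" "g \<in> carrier G"
  shows "x g \<in> I"
proof -
  have "family_sum R (carrier G) ` finsupp_families R (carrier G) (\<lambda>g. I \<inter> A g) = I"
    using assms(1) unfolding graded_ideal_def internal_direct_sum_def bij_betw_def by simp
  then have "family_sum R (carrier G) x
      \<in> family_sum R (carrier G) ` finsupp_families R (carrier G) (\<lambda>g. I \<inter> A g)"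
    using assms(3) by (simp only:)
  then obtain y where y: "y \<in> finsupp_families R (carrier G) (\<lambda>g. I \<inter> A g)"
      "family_sum R (carrier G) y = family_sum R (carrier G) x"
    by (rule imageE) auto
  then have "y = x"
    using finsupp_families_Int_subset assms(2) family_sum_bij
    unfolding bij_betw_def by (meson inj_onD subsetD)
  then show ?thesis using y(1) assms(4) by (auto simp: finsupp_families_def)
qed

lemma graded_idealI:
  assumes "ideal I R"
    and comp: "\<And>x g. \<lbrakk>x \<in> finsupp_families R (carrier G) A; family_sum R (carrier G) x \<in> I;
      g \<in> carrier G\<rbrakk> \<Longrightarrow> x g \<in> I"
  shows "graded_ideal G R A I"
proof -
  interpret I: ideal I R by fact
  let ?F = "finsupp_families R (carrier G)" and ?s = "family_sum R (carrier G)"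
  have "additive_subgroup (I \<inter> A g) R" if "g \<in> carrier G" for g
  proof -
    have "additive_subgroup (A g) R"
      using direct_sum that by (simp add: internal_direct_sum_def)
    then show ?thesis
      using I.a_subgroup R.add.subgroups_Inter_pair by (simp add: additive_subgroup_def)
  qed
  moreover have "?s ` ?F (\<lambda>g. I \<inter> A g) = I"
  proof
    show "?s ` ?F (\<lambda>g. I \<inter> A g) \<subseteq> I"
      by (auto simp: finsupp_families_def intro!: family_sum_mem_ideal[OF I.is_ideal])
    show "I \<subseteq> ?s ` ?F (\<lambda>g. I \<inter> A g)"
    proof
      fix i assume i: "i \<in> I"
      then have "i \<in> ?s ` ?F A"
        using family_sum_bij I.a_subset unfolding bij_betw_def by blast
      then obtain x where x: "x \<in> ?F A" "i = ?s x" by blast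
      have "x g \<in> I" if "g \<in> carrier G" for g
        using comp[OF x(1) _ that] i x(2) by simp
      then have "x \<in> ?F (\<lambda>g. I \<inter> A g)"
        using x(1) by (auto simp: finsupp_families_def PiE_iff)
      then show "i \<in> ?s ` ?F (\<lambda>g. I \<inter> A g)" using x(2) by blast
    qed
  qed
  moreover have "inj_on ?s (?F (\<lambda>g. I \<inter> A g))"
    using family_sum_bij finsupp_families_Int_subset by (metis bij_betw_def inj_on_subset)
  ultimately show ?thesis
    unfolding graded_ideal_def internal_direct_sum_def bij_betw_def
    using assms(1) by blast
qed

lemma graded_ideal_carrier: "graded_ideal G R A (carrier R)"
proof (rule graded_idealI)
  show "ideal (carrier R) R" by (rule R.oneideal)
  fix x g
  assume "x \<in> finsupp_families R (carrier G) A" "g \<in> carrier G"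
  then have "x g \<in> A g" "additive_subgroup (A g) R"
    using direct_sum by (auto simp: internal_direct_sum_def finsupp_families_def)
  then show "x g \<in> carrier R" using additive_subgroup.a_subset by blast
qed

lemma graded_ideal_Inter:
  assumes "\<K> \<noteq> {}" "\<And>I. I \<in> \<K> \<Longrightarrow> graded_ideal G R A I"
  shows "graded_ideal G R A (\<Inter>\<K>)"
proof (rule graded_idealI)
  show "ideal (\<Inter>\<K>) R"
    by (rule R.i_Intersect) (use assms in \<open>simp_all add: graded_ideal_def\<close>)
  fix x g
  assume x: "x \<in> finsupp_families R (carrier G) A" "family_sum R (carrier G) x \<in> \<Inter>\<K>"
    "g \<in> carrier G"
  show "x g \<in> \<Inter>\<K>"
  proof
    fix I assume "I \<in> \<K>"
    then show "x g \<in> I" using graded_ideal_component[OF assms(2) x(1) _ x(3)] x(2) by blast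
  qed
qed

lemma graded_ideal_subset:
  assumes "graded_ideal G R A I"
  shows "I \<subseteq> carrier R"
  using additive_subgroup.a_subset[OF ideal.axioms(1), of I R] assms by (simp add: graded_ideal_def)

lemma homogeneous_not_mem:
  assumes "graded_ideal G R A I" "ideal p R" "\<not> I \<subseteq> p"
  shows "\<exists>a\<in>I \<inter> homogeneous G A. a \<notin> p"
proof (rule ccontr)
  assume none: "\<not> ?thesis"
  have image: "family_sum R (carrier G) ` finsupp_families R (carrier G) (\<lambda>g. I \<inter> A g) = I"
    using assms(1) unfolding graded_ideal_def internal_direct_sum_def bij_betw_def by simp
  have mem: "family_sum R (carrier G) x \<in> p"
    if x: "x \<in> finsupp_families R (carrier G) (\<lambda>g. I \<inter> A g)" for x
  proof (rule family_sum_mem_ideal[OF assms(2)])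
    fix g assume g: "g \<in> carrier G"
    then have "x g \<in> I \<inter> A g" using x by (simp add: finsupp_families_def PiE_iff)
    then have "x g \<in> I \<inter> homogeneous G A" using g unfolding homogeneous_def by blast
    then show "x g \<in> p" using none by blast
  qed
  have "I \<subseteq> p"
  proof
    fix i assume "i \<in> I"
    then have "i \<in> family_sum R (carrier G) ` finsupp_families R (carrier G) (\<lambda>g. I \<inter> A g)"
      by (simp only: image)
    then show "i \<in> p" by (rule imageE) (simp add: mem)
  qed
  then show False using assms(3) by blast
qed

lemma graded_variety_Int:
  assumes I: "graded_ideal G R A I" and J: "graded_ideal G R A J"
  shows "graded_variety G R A (I \<inter> J) = graded_variety G R A I \<union> graded_variety G R A J"
proof -
  have "I \<subseteq> p \<or> J \<subseteq> p" if p: "graded_prime_ideal G R A p" and sub: "I \<inter> J \<subseteq> p" for p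
  proof (rule ccontr)
    assume "\<not> ?thesis"
    then have nI: "\<not> I \<subseteq> p" and nJ: "\<not> J \<subseteq> p" by simp_all
    have pid: "ideal p R" using p by (simp add: graded_prime_ideal_def graded_ideal_def)
    obtain a where a: "a \<in> I" "a \<in> homogeneous G A" "a \<notin> p"
      using homogeneous_not_mem[OF I pid nI] by blast
    obtain b where b: "b \<in> J" "b \<in> homogeneous G A" "b \<notin> p"
      using homogeneous_not_mem[OF J pid nJ] by blast
    interpret I: ideal I R using I by (simp add: graded_ideal_def)
    interpret J: ideal J R using J by (simp add: graded_ideal_def)
    have "a \<otimes>\<^bsub>R\<^esub> b \<in> I \<inter> J"
      using I.I_r_closed[OF a(1)] J.I_l_closed[OF b(1)] I.a_subset J.a_subset a(1) b(1) by blast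
    then have "a \<otimes>\<^bsub>R\<^esub> b \<in> p" using sub by blast
    then have "a \<in> p \<or> b \<in> p" using p a(2) b(2) by (simp add: graded_prime_ideal_def)
    then show False using a(3) b(3) by blast
  qed
  then show ?thesis unfolding graded_variety_def graded_spectrum_def by blast
qed

lemma graded_variety_Inter:
  assumes "\<And>I. I \<in> \<K> \<Longrightarrow> graded_ideal G R A I"
  shows "\<exists>J. graded_ideal G R A J \<and>
    graded_variety G R A J = {p \<in> graded_spectrum G R A. \<forall>I\<in>\<K>. p \<in> graded_variety G R A I}"
proof -
  define \<L> where "\<L> = {L. graded_ideal G R A L \<and> \<Union>\<K> \<subseteq> L}"
  have "\<Union>\<K> \<subseteq> carrier R"
    using assms graded_ideal_subset by blast
  then have "carrier R \<in> \<L>" by (simp add: \<L>_def graded_ideal_carrier)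
  then have "graded_ideal G R A (\<Inter>\<L>)"
    by (intro graded_ideal_Inter) (blast, simp add: \<L>_def)
  moreover have "graded_variety G R A (\<Inter>\<L>) =
      {p \<in> graded_spectrum G R A. \<forall>I\<in>\<K>. p \<in> graded_variety G R A I}"
  proof -
    have "\<Inter>\<L> \<subseteq> p \<longleftrightarrow> \<Union>\<K> \<subseteq> p" if "p \<in> graded_spectrum G R A" for p
    proof -
      have "graded_ideal G R A p"
        using that by (simp add: graded_spectrum_def graded_prime_ideal_def)
      then show ?thesis unfolding \<L>_def by blast
    qed
    then show ?thesis by (auto simp: graded_variety_def)
  qed
  ultimately show ?thesis by blast
qed

lemma istopology_zariski:
  "istopology (\<lambda>U. \<exists>J. graded_ideal G R A J \<and> U = graded_spectrum G R A - graded_variety G R A J)"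
  (is "istopology ?O")
  unfolding istopology_def
proof (intro conjI allI impI)
  fix S T assume "?O S" "?O T"
  then obtain I J where IJ: "graded_ideal G R A I" "graded_ideal G R A J"
      "S = graded_spectrum G R A - graded_variety G R A I"
      "T = graded_spectrum G R A - graded_variety G R A J"
    by blast
  have "graded_ideal G R A (I \<inter> J)"
    using graded_ideal_Inter[of "{I, J}"] IJ(1,2) by auto
  moreover have "S \<inter> T = graded_spectrum G R A - graded_variety G R A (I \<inter> J)"
    unfolding IJ(3,4) graded_variety_Int[OF IJ(1,2)] by blast
  ultimately show "?O (S \<inter> T)" by blast
next
  fix \<U> assume U: "\<forall>U\<in>\<U>. ?O U"
  define \<K> where "\<K> = {I. graded_ideal G R A I \<and> graded_spectrum G R A - graded_variety G R A I \<in> \<U>}"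
  obtain J where J: "graded_ideal G R A J"
      "graded_variety G R A J = {p \<in> graded_spectrum G R A. \<forall>I\<in>\<K>. p \<in> graded_variety G R A I}"
    using graded_variety_Inter[of \<K>] \<K>_def by auto
  have "\<Union>\<U> = (\<Union>I\<in>\<K>. graded_spectrum G R A - graded_variety G R A I)"
  proof (intro equalityI subsetI)
    fix p assume "p \<in> \<Union>\<U>"
    then obtain U where "U \<in> \<U>" "p \<in> U" by blast
    moreover from this(1) U obtain I where "graded_ideal G R A I"
        "U = graded_spectrum G R A - graded_variety G R A I" by blast
    ultimately show "p \<in> (\<Union>I\<in>\<K>. graded_spectrum G R A - graded_variety G R A I)"
      by (auto simp: \<K>_def)
  qed (auto simp: \<K>_def)
  also have "\<dots> = graded_spectrum G R A - graded_variety G R A J"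
    unfolding J(2) by auto
  finally show "?O (\<Union>\<U>)" using J(1) by blast
qed

lemma openin_zariski:
  "openin (zariski_topology G R A) U \<longleftrightarrow>
    (\<exists>J. graded_ideal G R A J \<and> U = graded_spectrum G R A - graded_variety G R A J)"
  unfolding zariski_topology_def by (simp add: topology_inverse'[OF istopology_zariski])

lemma topspace_zariski: "topspace (zariski_topology G R A) = graded_spectrum G R A"
proof -
  have "graded_variety G R A (carrier R) = {}"
    unfolding graded_variety_def graded_spectrum_def graded_prime_ideal_def
    using graded_ideal_subset by blast
  then have "openin (zariski_topology G R A) (graded_spectrum G R A)"
    unfolding openin_zariski using graded_ideal_carrier by blast
  moreover have "U \<subseteq> graded_spectrum G R A" if "openin (zariski_topology G R A) U" for U
    using that unfolding openin_zariski by blast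
  ultimately show ?thesis unfolding topspace_def by blast
qed

lemma closedin_zariski:
  "closedin (zariski_topology G R A) C \<longleftrightarrow>
    (\<exists>J. graded_ideal G R A J \<and> C = graded_variety G R A J)"
proof -
  have sub: "graded_variety G R A J \<subseteq> graded_spectrum G R A" for J
    unfolding graded_variety_def by blast
  have "C \<subseteq> graded_spectrum G R A \<and>
      graded_spectrum G R A - C = graded_spectrum G R A - graded_variety G R A J \<longleftrightarrow>
      C = graded_variety G R A J" for J
    using sub[of J] by blast
  then show ?thesis
    unfolding closedin_def topspace_zariski openin_zariski by metis
qed

end

end

theory Submission
  imports Defs "HOL-Algebra.Ring_Divisibility"
begin

text \<open>
  By a graded Nullstellensatz, \<open>Gr I\<close> is the intersection of \<open>V I\<close>, so \<open>I\<close> is an RFG ideal iff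
  \<open>V I = V F\<close> for a finite set \<open>F\<close> of homogeneous elements. If the spectrum is Noetherian, a minimal
  \<open>V F\<close> with \<open>F \<subseteq> p\<close> finite equals \<open>V p\<close>. Conversely, a graded ideal maximal among those that are not
  RFG is prime, so if the graded primes are RFG then all graded ideals are; a chain of ideals whose
  union has the variety of a finite set stabilises up to radical, since powers of the finitely many
  elements already lie in one member of the chain. Both the Nullstellensatz and the maximality
  argument are instances of one prime ideal principle in the style of Lam and Reyes.
\<close>

context graded_cring
begin

section \<open>Homogeneous components\<close>

text \<open>Inverting the bijection \<open>family_sum\<close> returns a member of
  \<open>finsupp_families\<close>. Such families are extensional, so the value is meaningful only
  for \<open>g\<close> in \<open>carrier G\<close> and \<open>r\<close> in
  \<open>carrier R\<close>.\<close>

definition component :: "'g \<Rightarrow> 'a \<Rightarrow> 'a"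
  where "component g r =
    the_inv_into (finsupp_families R (carrier G) A) (family_sum R (carrier G)) r g"

lemma grade_additive_subgroup: "g \<in> carrier G \<Longrightarrow> additive_subgroup (A g) R"
  using direct_sum by (simp add: internal_direct_sum_def)

lemma grade_subset: "g \<in> carrier G \<Longrightarrow> A g \<subseteq> carrier R"
  using grade_additive_subgroup additive_subgroup.a_subset by blast

lemma zero_mem_grade: "g \<in> carrier G \<Longrightarrow> \<zero>\<^bsub>R\<^esub> \<in> A g"
  using grade_additive_subgroup additive_subgroup.zero_closed by blast

lemma homogeneous_carrier: "homogeneous G A \<subseteq> carrier R"
  unfolding homogeneous_def using grade_subset by blast

lemma homogeneous_mult:
  "\<lbrakk>a \<in> homogeneous G A; b \<in> homogeneous G A\<rbrakk> \<Longrightarrow> a \<otimes>\<^bsub>R\<^esub> b \<in> homogeneous G A"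
  unfolding homogeneous_def using mult_mem by blast

lemma homogeneous_pow:
  assumes "a \<in> homogeneous G A" "n > 0"
  shows "a [^]\<^bsub>R\<^esub> (n::nat) \<in> homogeneous G A"
  using assms(2)
proof (induction n rule: nat_induct_non_zero)
  case 1
  then show ?case using assms(1) homogeneous_carrier by auto
next
  case (Suc n)
  then show ?case using homogeneous_mult assms(1) by simp
qed

lemma finsupp_families_mem:
  "\<lbrakk>x \<in> finsupp_families R (carrier G) A; g \<in> carrier G\<rbrakk> \<Longrightarrow> x g \<in> A g"
  by (auto simp: finsupp_families_def)

text \<open>The support may be enlarged by zero terms, so that families with different supports can
  be summed over one finite index set.\<close>

lemma family_sum_eq_finsum:
  assumes "x \<in> finsupp_families R (carrier G) A" "finite S" "S \<subseteq> carrier G"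
    and "{g \<in> carrier G. x g \<noteq> \<zero>\<^bsub>R\<^esub>} \<subseteq> S"
  shows "family_sum R (carrier G) x = (\<Oplus>\<^bsub>R\<^esub>g\<in>S. x g)"
  unfolding family_sum_def
proof (rule R.add.finprod_mono_neutral_cong_left)
  show "x \<in> S \<rightarrow> carrier R"
    using assms finsupp_families_mem grade_subset by blast
qed (use assms in auto)

lemma component_family:
  assumes "r \<in> carrier R"
  shows "(\<lambda>g. component g r) \<in> finsupp_families R (carrier G) A"
    and "family_sum R (carrier G) (\<lambda>g. component g r) = r"
proof -
  have eq: "(\<lambda>g. component g r) =
      the_inv_into (finsupp_families R (carrier G) A) (family_sum R (carrier G)) r"
    by (simp add: component_def fun_eq_iff)
  show "(\<lambda>g. component g r) \<in> finsupp_families R (carrier G) A"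
    unfolding eq using family_sum_bij assms
    by (metis bij_betw_def order_refl the_inv_into_into)
  show "family_sum R (carrier G) (\<lambda>g. component g r) = r"
    unfolding eq using family_sum_bij assms by (metis bij_betw_def f_the_inv_into_f)
qed

lemma component_family_sum:
  "x \<in> finsupp_families R (carrier G) A \<Longrightarrow> component g (family_sum R (carrier G) x) = x g"
  unfolding component_def using family_sum_bij by (metis bij_betw_def the_inv_into_f_f)

lemma component_mem: "\<lbrakk>r \<in> carrier R; g \<in> carrier G\<rbrakk> \<Longrightarrow> component g r \<in> A g"
  using component_family(1) finsupp_families_mem by blast

lemma component_homogeneous:
  "\<lbrakk>r \<in> carrier R; g \<in> carrier G\<rbrakk> \<Longrightarrow> component g r \<in> homogeneous G A"
  using component_mem unfolding homogeneous_def by blast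

lemma component_closed [simp]: "\<lbrakk>r \<in> carrier R; g \<in> carrier G\<rbrakk> \<Longrightarrow> component g r \<in> carrier R"
  using component_homogeneous homogeneous_carrier by blast

lemma finite_component_support: "r \<in> carrier R \<Longrightarrow> finite {g \<in> carrier G. component g r \<noteq> \<zero>\<^bsub>R\<^esub>}"
  using component_family(1)[of r] by (simp add: finsupp_families_def)

lemma component_sum:
  "r \<in> carrier R \<Longrightarrow> r = (\<Oplus>\<^bsub>R\<^esub>g\<in>{g \<in> carrier G. component g r \<noteq> \<zero>\<^bsub>R\<^esub>}. component g r)"
  using component_family(2)[of r] by (simp add: family_sum_def)

lemma component_zero:
  assumes "g \<in> carrier G"
  shows "component g \<zero>\<^bsub>R\<^esub> = \<zero>\<^bsub>R\<^esub>"
proof -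
  let ?z = "\<lambda>g\<in>carrier G. \<zero>\<^bsub>R\<^esub>"
  have "?z \<in> finsupp_families R (carrier G) A"
    using zero_mem_grade by (auto simp: finsupp_families_def)
  moreover from this have "family_sum R (carrier G) ?z = \<zero>\<^bsub>R\<^esub>"
    using family_sum_eq_finsum[of ?z "{}"] by auto
  ultimately show ?thesis using component_family_sum[of ?z g] assms by simp
qed

text \<open>The pointwise sum of the two component families has sum \<open>r \<oplus> s\<close>, and
  a decomposition into components is unique.\<close>

lemma component_add:
  assumes r: "r \<in> carrier R" and s: "s \<in> carrier R" and g: "g \<in> carrier G"
  shows "component g (r \<oplus>\<^bsub>R\<^esub> s) = component g r \<oplus>\<^bsub>R\<^esub> component g s"
proof -
  let ?z = "\<lambda>g\<in>carrier G. component g r \<oplus>\<^bsub>R\<^esub> component g s"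
  define S where "S = {g \<in> carrier G. component g r \<noteq> \<zero>\<^bsub>R\<^esub>} \<union> {g \<in> carrier G. component g s \<noteq> \<zero>\<^bsub>R\<^esub>}"
  have S: "finite S" "S \<subseteq> carrier G"
    using finite_component_support r s by (auto simp: S_def)
  have supp: "{g \<in> carrier G. ?z g \<noteq> \<zero>\<^bsub>R\<^esub>} \<subseteq> S"
    by (auto simp: S_def)
  have z: "?z \<in> finsupp_families R (carrier G) A"
    using finite_subset[OF supp S(1)] component_mem r s
      additive_subgroup.a_closed[OF grade_additive_subgroup]
    by (auto simp: finsupp_families_def)
  have "family_sum R (carrier G) ?z = (\<Oplus>\<^bsub>R\<^esub>g\<in>S. ?z g)"
    by (rule family_sum_eq_finsum[OF z S supp])
  also have "\<dots> = (\<Oplus>\<^bsub>R\<^esub>g\<in>S. component g r \<oplus>\<^bsub>R\<^esub> component g s)"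
    using S(2) r s by (intro R.finsum_cong') auto
  also have "\<dots> = (\<Oplus>\<^bsub>R\<^esub>g\<in>S. component g r) \<oplus>\<^bsub>R\<^esub> (\<Oplus>\<^bsub>R\<^esub>g\<in>S. component g s)"
    using S(2) r s by (intro R.finsum_addf) auto
  also have "(\<Oplus>\<^bsub>R\<^esub>g\<in>S. component g r) = r"
    using family_sum_eq_finsum[OF component_family(1)[OF r] S] component_family(2)[OF r]
    by (auto simp: S_def)
  also have "(\<Oplus>\<^bsub>R\<^esub>g\<in>S. component g s) = s"
    using family_sum_eq_finsum[OF component_family(1)[OF s] S] component_family(2)[OF s]
    by (auto simp: S_def)
  finally have sum: "family_sum R (carrier G) ?z = r \<oplus>\<^bsub>R\<^esub> s" .
  show ?thesis using component_family_sum[OF z, of g] g unfolding sum by simp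
qed

text \<open>Multiplication by an element of degree \<open>h\<close> shifts the grading by
  \<open>h\<close>. The shifted family sums to \<open>r \<otimes> y\<close>, and uniqueness of the
  decomposition identifies its entries.\<close>

lemma component_mult:
  assumes r: "r \<in> carrier R" and h: "h \<in> carrier G" and y: "y \<in> A h" and g: "g \<in> carrier G"
  shows "component (g \<otimes>\<^bsub>G\<^esub> h) (r \<otimes>\<^bsub>R\<^esub> y) = component g r \<otimes>\<^bsub>R\<^esub> y"
proof -
  \<comment> \<open>The part of \<open>r\<close> that \<open>y\<close> carries into degree
    \<open>k\<close> is the one in degree \<open>k\<close> times the inverse of
    \<open>h\<close>.\<close>
  let ?z = "\<lambda>k\<in>carrier G. component (k \<otimes>\<^bsub>G\<^esub> inv\<^bsub>G\<^esub> h) r \<otimes>\<^bsub>R\<^esub> y"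
  let ?S = "{g \<in> carrier G. component g r \<noteq> \<zero>\<^bsub>R\<^esub>}"
  have yR: "y \<in> carrier R" using y h grade_subset by blast
  have cancel: "k \<otimes>\<^bsub>G\<^esub> h \<otimes>\<^bsub>G\<^esub> inv\<^bsub>G\<^esub> h = k" "k \<otimes>\<^bsub>G\<^esub> inv\<^bsub>G\<^esub> h \<otimes>\<^bsub>G\<^esub> h = k"
    if "k \<in> carrier G" for k
    using that h by (simp_all add: G.m_assoc)
  have S: "finite ?S" "(\<lambda>k. k \<otimes>\<^bsub>G\<^esub> h) ` ?S \<subseteq> carrier G"
    using finite_component_support r h by auto
  have supp: "{k \<in> carrier G. ?z k \<noteq> \<zero>\<^bsub>R\<^esub>} \<subseteq> (\<lambda>k. k \<otimes>\<^bsub>G\<^esub> h) ` ?S"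
  proof
    fix k assume k: "k \<in> {k \<in> carrier G. ?z k \<noteq> \<zero>\<^bsub>R\<^esub>}"
    then have "k \<otimes>\<^bsub>G\<^esub> inv\<^bsub>G\<^esub> h \<in> ?S" using h yR by auto
    then show "k \<in> (\<lambda>k. k \<otimes>\<^bsub>G\<^esub> h) ` ?S"
      using cancel(2)[of k] k by (intro image_eqI[of _ _ "k \<otimes>\<^bsub>G\<^esub> inv\<^bsub>G\<^esub> h"]) auto
  qed
  have "?z k \<in> A k" if k: "k \<in> carrier G" for k
  proof -
    have "component (k \<otimes>\<^bsub>G\<^esub> inv\<^bsub>G\<^esub> h) r \<otimes>\<^bsub>R\<^esub> y \<in> A (k \<otimes>\<^bsub>G\<^esub> inv\<^bsub>G\<^esub> h \<otimes>\<^bsub>G\<^esub> h)"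
      using component_mem r h y k by (intro mult_mem) auto
    then show ?thesis using cancel(2)[OF k] k by simp
  qed
  then have z: "?z \<in> finsupp_families R (carrier G) A"
    using finite_subset[OF supp finite_imageI[OF S(1)]] by (auto simp: finsupp_families_def)
  have inj: "inj_on (\<lambda>k. k \<otimes>\<^bsub>G\<^esub> h) ?S"
    using h by (auto simp: inj_on_def)
  have "family_sum R (carrier G) ?z = (\<Oplus>\<^bsub>R\<^esub>k\<in>(\<lambda>k. k \<otimes>\<^bsub>G\<^esub> h) ` ?S. ?z k)"
    by (rule family_sum_eq_finsum[OF z finite_imageI[OF S(1)] S(2) supp])
  \<comment> \<open>Translation by \<open>h\<close> is injective, so the sum can be taken over the
    support of \<open>r\<close>, where \<open>y\<close> factors out.\<close>
  also have "\<dots> = (\<Oplus>\<^bsub>R\<^esub>k\<in>?S. ?z (k \<otimes>\<^bsub>G\<^esub> h))"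
    using r h yR by (intro R.finsum_reindex[OF _ inj]) auto
  also have "\<dots> = (\<Oplus>\<^bsub>R\<^esub>k\<in>?S. component k r \<otimes>\<^bsub>R\<^esub> y)"
    using r h yR cancel(1) by (intro R.finsum_cong') auto
  also have "\<dots> = (\<Oplus>\<^bsub>R\<^esub>k\<in>?S. component k r) \<otimes>\<^bsub>R\<^esub> y"
    using r yR S(1) by (intro R.finsum_ldistr[symmetric]) auto
  also have "\<dots> = r \<otimes>\<^bsub>R\<^esub> y"
    using component_sum[OF r] by simp
  finally show ?thesis
    using component_family_sum[OF z, of "g \<otimes>\<^bsub>G\<^esub> h"] g h cancel(1)[OF g] by simp
qed

section \<open>Graded ideals\<close>

text \<open>A criterion that avoids the direct sum bijection; gradedness is mostly checked through
  it from here on.\<close>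

lemma graded_ideal_iff:
  "graded_ideal G R A I \<longleftrightarrow> ideal I R \<and> (\<forall>r\<in>I. \<forall>g\<in>carrier G. component g r \<in> I)"
proof
  assume I: "graded_ideal G R A I"
  have "component g r \<in> I" if r: "r \<in> I" and g: "g \<in> carrier G" for r g
  proof -
    have "r \<in> carrier R" using graded_ideal_subset[OF I] r by blast
    then show ?thesis
      using graded_ideal_component[OF I component_family(1)[of r] _ g] component_family(2)[of r] r
      by simp
  qed
  then show "ideal I R \<and> (\<forall>r\<in>I. \<forall>g\<in>carrier G. component g r \<in> I)"
    using I by (simp add: graded_ideal_def)
next
  assume I: "ideal I R \<and> (\<forall>r\<in>I. \<forall>g\<in>carrier G. component g r \<in> I)"
  show "graded_ideal G R A I"
    by (rule graded_idealI) (use I component_family_sum in force)+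
qed

lemma mem_ideal_if_components:
  assumes "ideal I R" "r \<in> carrier R" "\<And>g. g \<in> carrier G \<Longrightarrow> component g r \<in> I"
  shows "r \<in> I"
  using family_sum_mem_ideal[of I "\<lambda>g. component g r"] component_family(2)[OF assms(2)] assms
  by simp

lemma ideal_finsum_closed:
  assumes "ideal I R" "\<And>i. i \<in> S \<Longrightarrow> f i \<in> I"
  shows "(\<Oplus>\<^bsub>R\<^esub>i\<in>S. f i) \<in> I"
proof -
  interpret I: ideal I R by fact
  show ?thesis using assms(2)
  proof (induction S rule: infinite_finite_induct)
    case (insert i S)
    then have "f \<in> S \<rightarrow> carrier R" "f i \<in> carrier R" using I.a_subset by auto
    then show ?case using insert by (simp add: R.finsum_insert)
  qed (simp_all add: R.finsum_infinite)
qed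

text \<open>If \<open>a\<close> has degree \<open>h\<close>, each component of
  \<open>r \<otimes> a\<close> is a component of \<open>r\<close> times \<open>a\<close>, by the
  shift in \<open>component_mult\<close>.\<close>

lemma component_mult_mem:
  assumes I: "ideal I R" and r: "r \<in> carrier R" and a: "a \<in> homogeneous G A" "a \<in> I"
    and g: "g \<in> carrier G"
  shows "component g (r \<otimes>\<^bsub>R\<^esub> a) \<in> I"
proof -
  obtain h where h: "h \<in> carrier G" "a \<in> A h" using a(1) by (auto simp: homogeneous_def)
  have "component (g \<otimes>\<^bsub>G\<^esub> inv\<^bsub>G\<^esub> h \<otimes>\<^bsub>G\<^esub> h) (r \<otimes>\<^bsub>R\<^esub> a) = component (g \<otimes>\<^bsub>G\<^esub> inv\<^bsub>G\<^esub> h) r \<otimes>\<^bsub>R\<^esub> a"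
    using component_mult r h g by simp
  then show ?thesis
    using ideal.I_l_closed[OF I a(2), of "component (g \<otimes>\<^bsub>G\<^esub> inv\<^bsub>G\<^esub> h) r"] r g h(1)
    by (simp add: G.m_assoc)
qed

text \<open>Homogeneity of the generators keeps the components of every summand inside
  \<open>J\<close>, which makes \<open>J\<close> graded. The second claim reduces the variety of
  \<open>J\<close> to that of its generators.\<close>

lemma graded_ideal_linear_combinations:
  assumes r: "\<And>i. i < n \<Longrightarrow> r i \<in> homogeneous G A"
    and J: "J = {\<Oplus>\<^bsub>R\<^esub>i\<in>{..<n::nat}. s i \<otimes>\<^bsub>R\<^esub> r i | s. s \<in> {..<n} \<rightarrow> carrier R}"
  shows "graded_ideal G R A J" and "\<And>K. ideal K R \<Longrightarrow> J \<subseteq> K \<longleftrightarrow> r ` {..<n} \<subseteq> K"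
proof -
  have rR: "r i \<in> carrier R" if "i < n" for i using r homogeneous_carrier that by blast
  have memI: "(\<Oplus>\<^bsub>R\<^esub>i\<in>{..<n}. s i \<otimes>\<^bsub>R\<^esub> r i) \<in> J" if "\<And>i. i < n \<Longrightarrow> s i \<in> carrier R" for s
    using that unfolding J by blast
  have mem_carrier: "(\<Oplus>\<^bsub>R\<^esub>i\<in>{..<n}. s i \<otimes>\<^bsub>R\<^esub> r i) \<in> carrier R"
    if "s \<in> {..<n} \<rightarrow> carrier R" for s
    using that rR by (intro R.finsum_closed) auto
  have add: "x \<oplus>\<^bsub>R\<^esub> y \<in> J" if "x \<in> J" "y \<in> J" for x y
  proof -
    obtain s where s: "s \<in> {..<n} \<rightarrow> carrier R" "x = (\<Oplus>\<^bsub>R\<^esub>i\<in>{..<n}. s i \<otimes>\<^bsub>R\<^esub> r i)"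
      using \<open>x \<in> J\<close> unfolding J by blast
    obtain t where t: "t \<in> {..<n} \<rightarrow> carrier R" "y = (\<Oplus>\<^bsub>R\<^esub>i\<in>{..<n}. t i \<otimes>\<^bsub>R\<^esub> r i)"
      using \<open>y \<in> J\<close> unfolding J by blast
    have "x \<oplus>\<^bsub>R\<^esub> y = (\<Oplus>\<^bsub>R\<^esub>i\<in>{..<n}. s i \<otimes>\<^bsub>R\<^esub> r i \<oplus>\<^bsub>R\<^esub> t i \<otimes>\<^bsub>R\<^esub> r i)"
      unfolding s(2) t(2) using s(1) t(1) rR by (intro R.finsum_addf[symmetric]) auto
    also have "\<dots> = (\<Oplus>\<^bsub>R\<^esub>i\<in>{..<n}. (s i \<oplus>\<^bsub>R\<^esub> t i) \<otimes>\<^bsub>R\<^esub> r i)"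
      using s(1) t(1) rR by (intro R.finsum_cong') (auto simp: R.l_distr Pi_iff)
    also have "\<dots> \<in> J" using s(1) t(1) by (intro memI) auto
    finally show ?thesis .
  qed
  have mult: "c \<otimes>\<^bsub>R\<^esub> x \<in> J" if x: "x \<in> J" and c: "c \<in> carrier R" for x c
  proof -
    obtain s where s: "s \<in> {..<n} \<rightarrow> carrier R" "x = (\<Oplus>\<^bsub>R\<^esub>i\<in>{..<n}. s i \<otimes>\<^bsub>R\<^esub> r i)"
      using x unfolding J by blast
    have "c \<otimes>\<^bsub>R\<^esub> x = (\<Oplus>\<^bsub>R\<^esub>i\<in>{..<n}. c \<otimes>\<^bsub>R\<^esub> (s i \<otimes>\<^bsub>R\<^esub> r i))"
      unfolding s(2) using s(1) c rR by (intro R.finsum_rdistr) auto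
    also have "\<dots> = (\<Oplus>\<^bsub>R\<^esub>i\<in>{..<n}. (c \<otimes>\<^bsub>R\<^esub> s i) \<otimes>\<^bsub>R\<^esub> r i)"
      using s(1) c rR by (intro R.finsum_cong') (auto simp: R.m_assoc Pi_iff)
    also have "\<dots> \<in> J" using s(1) c by (intro memI) auto
    finally show ?thesis .
  qed
  have sub: "J \<subseteq> carrier R" unfolding J using mem_carrier by blast
  have J_ideal: "ideal J R"
  proof (rule idealI[OF R.ring_axioms])
    show "subgroup J (add_monoid R)"
    proof (rule R.add.subgroupI[OF sub])
      show "J \<noteq> {}" using memI[of "\<lambda>_. \<zero>\<^bsub>R\<^esub>"] by auto
      fix a assume a: "a \<in> J"
      then have "(\<ominus>\<^bsub>R\<^esub> \<one>\<^bsub>R\<^esub>) \<otimes>\<^bsub>R\<^esub> a \<in> J" by (intro mult) auto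
      then show "\<ominus>\<^bsub>R\<^esub> a \<in> J" using a sub by (simp add: R.l_minus subset_iff)
    qed (rule add)
    show "x \<otimes>\<^bsub>R\<^esub> a \<in> J" "a \<otimes>\<^bsub>R\<^esub> x \<in> J" if "a \<in> J" "x \<in> carrier R" for a x
      using mult[OF that] that sub R.m_comm[of a x] by auto
  qed
  have gen: "r i \<in> J" if i: "i < n" for i
  proof -
    \<comment> \<open>The coefficients are 1 at \<open>i\<close> and 0 elsewhere.\<close>
    have "(\<Oplus>\<^bsub>R\<^esub>j\<in>{..<n}. (if i = j then \<one>\<^bsub>R\<^esub> else \<zero>\<^bsub>R\<^esub>) \<otimes>\<^bsub>R\<^esub> r j) =
        (\<Oplus>\<^bsub>R\<^esub>j\<in>{..<n}. if i = j then r j else \<zero>\<^bsub>R\<^esub>)"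
      using rR by (intro R.finsum_cong') auto
    also have "\<dots> = r i" using i rR by (intro R.add.finprod_singleton) auto
    finally show ?thesis
      using memI[of "\<lambda>j. if i = j then \<one>\<^bsub>R\<^esub> else \<zero>\<^bsub>R\<^esub>"] by simp
  qed
  show "J \<subseteq> K \<longleftrightarrow> r ` {..<n} \<subseteq> K" if K: "ideal K R" for K
  proof
    show "r ` {..<n} \<subseteq> K" if "J \<subseteq> K" using that gen by blast
    assume "r ` {..<n} \<subseteq> K"
    then have "(\<Oplus>\<^bsub>R\<^esub>i\<in>{..<n}. s i \<otimes>\<^bsub>R\<^esub> r i) \<in> K" if "s \<in> {..<n} \<rightarrow> carrier R" for s
      using that by (intro ideal_finsum_closed[OF K] ideal.I_l_closed[OF K]) auto
    then show "J \<subseteq> K" unfolding J by blast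
  qed
  show "graded_ideal G R A J"
    unfolding graded_ideal_iff
  proof (intro conjI ballI J_ideal)
    fix x g assume x: "x \<in> J" and g: "g \<in> carrier G"
    obtain s where s: "s \<in> {..<n} \<rightarrow> carrier R" "x = (\<Oplus>\<^bsub>R\<^esub>i\<in>{..<n}. s i \<otimes>\<^bsub>R\<^esub> r i)"
      using x unfolding J by blast
    \<comment> \<open>The claim is generalised to partial sums over \<open>S\<close>, for an
      induction along which \<open>component_add\<close> splits off one summand.\<close>
    have "component g (\<Oplus>\<^bsub>R\<^esub>i\<in>S. s i \<otimes>\<^bsub>R\<^esub> r i) \<in> J" if "finite S" "S \<subseteq> {..<n}" for S
      using that
    proof (induction S)
      case empty
      then show ?case
        using component_zero[OF g] additive_subgroup.zero_closed[OF ideal.axioms(1)[OF J_ideal]]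
        by simp
    next
      case (insert i S)
      then have i: "i < n" "s i \<in> carrier R" and S: "(\<lambda>i. s i \<otimes>\<^bsub>R\<^esub> r i) \<in> S \<rightarrow> carrier R"
        using s(1) rR by auto
      have "component g (s i \<otimes>\<^bsub>R\<^esub> r i) \<in> J"
        using component_mult_mem[OF J_ideal i(2) r[OF i(1)] gen[OF i(1)] g] .
      then show ?case
        using insert i S rR g by (simp add: R.finsum_insert component_add add)
    qed
    then show "component g x \<in> J" unfolding s(2) by simp
  qed
qed

section \<open>Graded spans, colon ideals and unions of chains\<close>

text \<open>This is the graded ideal generated by \<open>S\<close> when \<open>S\<close> lies in
  \<open>carrier R\<close>; otherwise the family is empty and its intersection is
  \<open>UNIV\<close>.\<close>

definition graded_span :: "'a set \<Rightarrow> 'a set"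
  where "graded_span S = \<Inter>{I. graded_ideal G R A I \<and> S \<subseteq> I}"

lemma graded_ideal_span: "S \<subseteq> carrier R \<Longrightarrow> graded_ideal G R A (graded_span S)"
  unfolding graded_span_def using graded_ideal_carrier by (intro graded_ideal_Inter) auto

lemma graded_span_superset: "S \<subseteq> graded_span S"
  unfolding graded_span_def by blast

lemma graded_span_least: "\<lbrakk>graded_ideal G R A I; S \<subseteq> I\<rbrakk> \<Longrightarrow> graded_span S \<subseteq> I"
  unfolding graded_span_def by blast

text \<open>The set is the colon ideal \<open>(I : a)\<close>. Since \<open>a\<close> is
  homogeneous, multiplying by it only shifts components, so membership can be tested one degree at a
  time.\<close>

lemma graded_ideal_colon:
  assumes I: "graded_ideal G R A I" and a: "a \<in> homogeneous G A"
  shows "graded_ideal G R A {r \<in> carrier R. r \<otimes>\<^bsub>R\<^esub> a \<in> I}" (is "graded_ideal G R A ?Q")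
proof -
  interpret I: ideal I R using I by (simp add: graded_ideal_def)
  obtain h where h: "h \<in> carrier G" "a \<in> A h" using a by (auto simp: homogeneous_def)
  have aR: "a \<in> carrier R" using a homogeneous_carrier by blast
  have "ideal ?Q R"
  proof (rule idealI[OF R.ring_axioms])
    show "subgroup ?Q (add_monoid R)"
    proof (rule R.add.subgroupI)
      have "\<zero>\<^bsub>R\<^esub> \<in> ?Q" using aR I.zero_closed by simp
      then show "?Q \<noteq> {}" by blast
    qed (use aR in \<open>auto simp: R.l_minus R.l_distr intro: I.a_inv_closed I.a_closed\<close>)
    show mult: "x \<otimes>\<^bsub>R\<^esub> r \<in> ?Q" if "r \<in> ?Q" "x \<in> carrier R" for r x
      using that aR I.I_l_closed by (simp add: R.m_assoc)
    then show "r \<otimes>\<^bsub>R\<^esub> x \<in> ?Q" if "r \<in> ?Q" "x \<in> carrier R" for r x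
      using that R.m_comm[of r x] by force
  qed
  moreover have "component g r \<in> ?Q" if r: "r \<in> ?Q" and g: "g \<in> carrier G" for r g
  proof -
    have "component (g \<otimes>\<^bsub>G\<^esub> h) (r \<otimes>\<^bsub>R\<^esub> a) \<in> I"
      using I r g h(1) by (simp add: graded_ideal_iff)
    then show ?thesis using component_mult[OF _ h g, of r] r g by simp
  qed
  ultimately show ?thesis by (simp add: graded_ideal_iff)
qed

lemma graded_ideal_chain_Union:
  assumes "\<C> \<noteq> {}" "subset.chain {I. graded_ideal G R A I} \<C>"
  shows "graded_ideal G R A (\<Union>\<C>)"
proof -
  have "subset.chain {I. ideal I R} \<C>"
    using assms(2) by (auto simp: subset.chain_def graded_ideal_def)
  then have "ideal (\<Union>\<C>) R"
    using R.chain_Union_is_ideal[of \<C>] assms(1) by simp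
  moreover have "component g r \<in> \<Union>\<C>" if "r \<in> \<Union>\<C>" "g \<in> carrier G" for r g
    using that assms(2) by (auto simp: subset.chain_def graded_ideal_iff)
  ultimately show ?thesis by (simp add: graded_ideal_iff)
qed

section \<open>Graded prime ideals\<close>

lemma graded_prime_pow_mem:
  assumes p: "graded_prime_ideal G R A p" and a: "a \<in> homogeneous G A"
    and "n > 0" "a [^]\<^bsub>R\<^esub> (n::nat) \<in> p"
  shows "a \<in> p"
  using assms(3,4)
proof (induction n rule: nat_induct_non_zero)
  case 1
  then show ?case using a homogeneous_carrier by auto
next
  case (Suc n)
  then have "a [^]\<^bsub>R\<^esub> n \<otimes>\<^bsub>R\<^esub> a \<in> p" by simp
  then have "a [^]\<^bsub>R\<^esub> n \<in> p \<or> a \<in> p"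
    using p a homogeneous_pow[OF a Suc.hyps] by (simp add: graded_prime_ideal_def)
  then show ?case using Suc.IH by blast
qed

text \<open>By \<open>chain\<close>, Zorn's lemma gives a \<open>p\<close> maximal among the graded
  ideals above \<open>J\<close> that fail \<F>. It is proper by \<open>carrier\<close>. If
  \<open>a\<close> and \<open>b\<close> were outside \<open>p\<close> but their product inside, both
  larger spans would satisfy \<F> by maximality, and \<open>oka\<close> would give
  \<open>\<F> p\<close>.\<close>

lemma graded_prime_ideal_principle:
  assumes carrier: "\<F> (carrier R)"
    and oka: "\<And>I a b. \<lbrakk>graded_ideal G R A I; a \<in> homogeneous G A; b \<in> homogeneous G A;
      a \<otimes>\<^bsub>R\<^esub> b \<in> I; \<F> (graded_span (insert a I)); \<F> (graded_span (insert b I))\<rbrakk> \<Longrightarrow> \<F> I"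
    and chain: "\<And>\<C>. \<lbrakk>\<C> \<noteq> {}; subset.chain {I. graded_ideal G R A I} \<C>; \<F> (\<Union>\<C>)\<rbrakk> \<Longrightarrow> \<exists>I\<in>\<C>. \<F> I"
    and J: "graded_ideal G R A J" "\<not> \<F> J"
  shows "\<exists>p. graded_prime_ideal G R A p \<and> J \<subseteq> p \<and> \<not> \<F> p"
proof -
  define \<N> where "\<N> = {I. graded_ideal G R A I \<and> J \<subseteq> I \<and> \<not> \<F> I}"
  have "\<exists>M\<in>\<N>. \<forall>X\<in>\<N>. M \<subseteq> X \<longrightarrow> X = M"
  proof (rule subset_Zorn_nonempty)
    show "\<N> \<noteq> {}" using J by (auto simp: \<N>_def)
    fix \<C> assume \<C>: "\<C> \<noteq> {}" "subset.chain \<N> \<C>"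
    then have ch: "subset.chain {I. graded_ideal G R A I} \<C>"
      and sub: "\<C> \<subseteq> \<N>"
      by (auto simp: subset.chain_def \<N>_def)
    \<comment> \<open>This is the contrapositive of \<open>chain\<close>: no member of \<C>
      satisfies \<F>, so the union, which is the upper bound for Zorn, does not either.\<close>
    have "\<not> \<F> (\<Union>\<C>)" using chain[OF \<C>(1) ch] sub by (auto simp: \<N>_def)
    moreover have "J \<subseteq> \<Union>\<C>" using sub \<C>(1) by (auto simp: \<N>_def)
    ultimately show "\<Union>\<C> \<in> \<N>"
      using graded_ideal_chain_Union[OF \<C>(1) ch] by (simp add: \<N>_def)
  qed
  then obtain p where pN: "p \<in> \<N>" and pmax: "\<forall>X\<in>\<N>. p \<subseteq> X \<longrightarrow> X = p"
    by (rule bexE)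
  then have p: "graded_ideal G R A p" "J \<subseteq> p" "\<not> \<F> p"
    by (simp_all add: \<N>_def)
  have max: "X = p" if "graded_ideal G R A X" "p \<subseteq> X" "\<not> \<F> X" for X
    using pmax that p(2) by (simp add: \<N>_def)
  have span: "\<F> (graded_span (insert a p))" if "a \<in> homogeneous G A" "a \<notin> p" for a
  proof (rule ccontr)
    assume *: "\<not> ?thesis"
    have "insert a p \<subseteq> carrier R"
      using that homogeneous_carrier graded_ideal_subset[OF p(1)] by blast
    then have "graded_span (insert a p) = p"
      using * graded_span_superset[of "insert a p"] by (intro max graded_ideal_span) auto
    then show False using graded_span_superset[of "insert a p"] that(2) by blast
  qed
  have "p \<noteq> carrier R" using carrier p(3) by auto
  then have "graded_prime_ideal G R A p"
    unfolding graded_prime_ideal_def using p span oka by blast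
  then show ?thesis using p by blast
qed

text \<open>The prime ideal principle is applied to the property of containing a positive power of
  \<open>a\<close>.\<close>

lemma graded_prime_avoiding_powers:
  assumes J: "graded_ideal G R A J" and a: "a \<in> homogeneous G A"
    and "\<And>n::nat. n > 0 \<Longrightarrow> a [^]\<^bsub>R\<^esub> n \<notin> J"
  shows "\<exists>p. graded_prime_ideal G R A p \<and> J \<subseteq> p \<and> a \<notin> p"
proof -
  have aR: "a \<in> carrier R" using a homogeneous_carrier by blast
  have "\<exists>p. graded_prime_ideal G R A p \<and> J \<subseteq> p \<and> \<not> (\<exists>n::nat. n > 0 \<and> a [^]\<^bsub>R\<^esub> n \<in> p)"
  proof (rule graded_prime_ideal_principle)
    show "\<exists>n::nat. n > 0 \<and> a [^]\<^bsub>R\<^esub> n \<in> carrier R" using aR by auto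
    show "\<exists>I\<in>\<C>. \<exists>n::nat. n > 0 \<and> a [^]\<^bsub>R\<^esub> n \<in> I"
      if "\<exists>n::nat. n > 0 \<and> a [^]\<^bsub>R\<^esub> n \<in> \<Union>\<C>" for \<C>
      using that by blast
    show "graded_ideal G R A J" "\<not> (\<exists>n::nat. n > 0 \<and> a [^]\<^bsub>R\<^esub> n \<in> J)" using assms by auto
    fix I x y
    assume I: "graded_ideal G R A I" and x: "x \<in> homogeneous G A" and y: "y \<in> homogeneous G A"
      and xy: "x \<otimes>\<^bsub>R\<^esub> y \<in> I"
      and "\<exists>n::nat. n > 0 \<and> a [^]\<^bsub>R\<^esub> n \<in> graded_span (insert x I)"
      and "\<exists>n::nat. n > 0 \<and> a [^]\<^bsub>R\<^esub> n \<in> graded_span (insert y I)"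
    then obtain m n :: nat where m: "m > 0" "a [^]\<^bsub>R\<^esub> m \<in> graded_span (insert x I)"
      and n: "n > 0" "a [^]\<^bsub>R\<^esub> n \<in> graded_span (insert y I)"
      by blast
    interpret I: ideal I R using I by (simp add: graded_ideal_def)
    have xR: "x \<in> carrier R" and yR: "y \<in> carrier R"
      using x y homogeneous_carrier by auto
    have sub: "I \<subseteq> {r \<in> carrier R. r \<otimes>\<^bsub>R\<^esub> b \<in> I}" if "b \<in> carrier R" for b
      using that I.I_r_closed I.a_subset by blast
    \<comment> \<open>The graded ideal \<open>(I : y)\<close> contains \<open>I\<close>, and also
      \<open>x\<close> because \<open>x \<otimes> y\<close> is in \<open>I\<close>; so it contains
      the span of both.\<close>
    have "a [^]\<^bsub>R\<^esub> m \<in> {r \<in> carrier R. r \<otimes>\<^bsub>R\<^esub> y \<in> I}"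
      using graded_span_least[OF graded_ideal_colon[OF I y], of "insert x I"] sub[OF yR] xR xy m(2)
      by auto
    then have "y \<otimes>\<^bsub>R\<^esub> a [^]\<^bsub>R\<^esub> m \<in> I"
      using R.m_comm[OF yR, of "a [^]\<^bsub>R\<^esub> m"] by simp
    \<comment> \<open>The same argument for the colon ideal of the \<open>m\<close>-th power of
      \<open>a\<close>, which has just been shown to contain \<open>y\<close>.\<close>
    then have "a [^]\<^bsub>R\<^esub> n \<in> {r \<in> carrier R. r \<otimes>\<^bsub>R\<^esub> a [^]\<^bsub>R\<^esub> m \<in> I}"
      using graded_span_least[OF graded_ideal_colon[OF I homogeneous_pow[OF a m(1)]], of "insert y I"]
        sub[of "a [^]\<^bsub>R\<^esub> m"] aR yR n(2)
      by auto
    then have "a [^]\<^bsub>R\<^esub> (n + m) \<in> I" using aR by (simp add: R.nat_pow_mult)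
    then show "\<exists>n::nat. n > 0 \<and> a [^]\<^bsub>R\<^esub> n \<in> I" using m(1) by (intro exI[of _ "n + m"]) simp
  qed
  then obtain p where p: "graded_prime_ideal G R A p" "J \<subseteq> p"
    "\<not> (\<exists>n::nat. n > 0 \<and> a [^]\<^bsub>R\<^esub> n \<in> p)" by blast
  have "a \<notin> p" using p(3)[simplified, rule_format, of 1] aR by simp
  then show ?thesis using p by blast
qed

section \<open>Varieties and radicals\<close>

lemma graded_variety_mem:
  "p \<in> graded_variety G R A S \<longleftrightarrow> graded_prime_ideal G R A p \<and> S \<subseteq> p"
  by (simp add: graded_variety_def graded_spectrum_def)

lemma graded_variety_antimono: "S \<subseteq> T \<Longrightarrow> graded_variety G R A T \<subseteq> graded_variety G R A S"
  by (auto simp: graded_variety_def)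

lemma graded_variety_empty_set: "graded_variety G R A {} = graded_spectrum G R A"
  by (auto simp: graded_variety_def)

lemma graded_variety_Un:
  "graded_variety G R A (S \<union> T) = graded_variety G R A S \<inter> graded_variety G R A T"
  by (auto simp: graded_variety_def)

lemma graded_prime_imp_graded: "graded_prime_ideal G R A p \<Longrightarrow> graded_ideal G R A p"
  by (simp add: graded_prime_ideal_def)

lemma graded_prime_imp_ideal: "graded_prime_ideal G R A p \<Longrightarrow> ideal p R"
  by (simp add: graded_prime_ideal_def graded_ideal_def)

lemma graded_variety_span: "graded_variety G R A (graded_span S) = graded_variety G R A S"
proof -
  have "graded_span S \<subseteq> p \<longleftrightarrow> S \<subseteq> p" if "graded_prime_ideal G R A p" for p
    using graded_span_superset[of S] graded_span_least[OF graded_prime_imp_graded[OF that]] by blast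
  then show ?thesis by (auto simp: graded_variety_def graded_spectrum_def)
qed

lemma graded_variety_carrier: "graded_variety G R A (carrier R) = {}"
  unfolding graded_variety_def graded_spectrum_def graded_prime_ideal_def
  using graded_ideal_subset by blast

text \<open>The graded Nullstellensatz for homogeneous elements: one direction is the existence of
  primes avoiding all powers, the other is primality.\<close>

lemma homogeneous_power_mem_iff:
  assumes I: "graded_ideal G R A I" and a: "a \<in> homogeneous G A"
  shows "(\<exists>n::nat. n > 0 \<and> a [^]\<^bsub>R\<^esub> n \<in> I) \<longleftrightarrow> (\<forall>p\<in>graded_variety G R A I. a \<in> p)"
  using graded_prime_avoiding_powers[OF I a] graded_prime_pow_mem[OF _ a]
  unfolding graded_variety_mem Ball_def by blast

text \<open>The radical is defined degree by degree, so the homogeneous case applies to each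
  component; a graded prime contains \<open>r\<close> exactly if it contains all components of
  \<open>r\<close>.\<close>

lemma graded_radical_eq:
  assumes I: "graded_ideal G R A I"
  shows "graded_radical G R A I = {r \<in> carrier R. \<forall>p\<in>graded_variety G R A I. r \<in> p}"
proof -
  have "graded_radical G R A I = {r \<in> carrier R.
      \<forall>g\<in>carrier G. \<exists>n::nat. n > 0 \<and> component g r [^]\<^bsub>R\<^esub> n \<in> I}" (is "_ = ?Q")
  proof (intro equalityI subsetI)
    fix r assume "r \<in> graded_radical G R A I"
    then obtain x where x: "x \<in> finsupp_families R (carrier G) A" "r = family_sum R (carrier G) x"
      "\<forall>g\<in>carrier G. \<exists>n::nat. n > 0 \<and> x g [^]\<^bsub>R\<^esub> n \<in> I"
      by (auto simp: graded_radical_def)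
    have "r \<in> carrier R" using x family_sum_bij by (auto simp: bij_betw_def)
    then show "r \<in> ?Q" using x component_family_sum[OF x(1)] by simp
  next
    fix r assume r: "r \<in> ?Q"
    then show "r \<in> graded_radical G R A I"
      unfolding graded_radical_def using component_family[of r]
      by (intro CollectI exI[of _ "\<lambda>g. component g r"]) auto
  qed
  also have "\<dots> = {r \<in> carrier R. \<forall>p\<in>graded_variety G R A I. r \<in> p}"
  proof (rule Collect_cong, rule conj_cong[OF refl])
    fix r assume r: "r \<in> carrier R"
    have "(\<forall>g\<in>carrier G. \<exists>n::nat. n > 0 \<and> component g r [^]\<^bsub>R\<^esub> n \<in> I) \<longleftrightarrow>
        (\<forall>g\<in>carrier G. \<forall>p\<in>graded_variety G R A I. component g r \<in> p)"
      using homogeneous_power_mem_iff[OF I component_homogeneous[OF r]] by simp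
    also have "\<dots> \<longleftrightarrow> (\<forall>p\<in>graded_variety G R A I. \<forall>g\<in>carrier G. component g r \<in> p)"
      by blast
    also have "\<dots> \<longleftrightarrow> (\<forall>p\<in>graded_variety G R A I. r \<in> p)"
      using mem_ideal_if_components[OF graded_prime_imp_ideal r] graded_prime_imp_graded
      by (intro ball_cong[OF refl]) (auto simp: graded_variety_mem graded_ideal_iff)
    finally show "(\<forall>g\<in>carrier G. \<exists>n::nat. n > 0 \<and> component g r [^]\<^bsub>R\<^esub> n \<in> I) \<longleftrightarrow>
        (\<forall>p\<in>graded_variety G R A I. r \<in> p)" .
  qed
  finally show ?thesis .
qed

text \<open>Inserting \<open>carrier R\<close> keeps the intersection correct for an empty variety
  and the family nonempty for \<open>graded_ideal_Inter\<close>.\<close>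

lemma graded_radical_eq_Inter:
  assumes "graded_ideal G R A I"
  shows "graded_radical G R A I = \<Inter>(insert (carrier R) (graded_variety G R A I))"
  using graded_radical_eq[OF assms] by auto

lemma graded_ideal_radical:
  assumes "graded_ideal G R A I"
  shows "graded_ideal G R A (graded_radical G R A I)"
  unfolding graded_radical_eq_Inter[OF assms]
  by (rule graded_ideal_Inter)
    (auto simp: graded_ideal_carrier graded_variety_mem graded_prime_imp_graded)

lemma graded_variety_radical:
  assumes I: "graded_ideal G R A I"
  shows "graded_variety G R A (graded_radical G R A I) = graded_variety G R A I"
  using graded_ideal_subset[OF I]
  unfolding graded_radical_eq[OF I] graded_variety_def by blast

text \<open>Radical and variety determine each other, so equality of radicals can be replaced by
  equality of closed sets.\<close>

lemma graded_radical_eq_iff: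
  assumes "graded_ideal G R A I" "graded_ideal G R A J"
  shows "graded_radical G R A I = graded_radical G R A J \<longleftrightarrow>
    graded_variety G R A I = graded_variety G R A J"
proof
  show "graded_variety G R A I = graded_variety G R A J"
    if "graded_radical G R A I = graded_radical G R A J"
    using that graded_variety_radical[OF assms(1)] graded_variety_radical[OF assms(2)] by simp
  show "graded_radical G R A I = graded_radical G R A J"
    if "graded_variety G R A I = graded_variety G R A J"
    using that by (simp only: graded_radical_eq assms)
qed

section \<open>Finite sets of homogeneous elements\<close>

lemma graded_finitely_generated_imp_finite:
  assumes "graded_finitely_generated G R A J"
  shows "\<exists>F. finite F \<and> F \<subseteq> homogeneous G A \<and> graded_variety G R A J = graded_variety G R A F"
proof -
  obtain n :: nat and r where r: "\<And>i. i < n \<Longrightarrow> r i \<in> homogeneous G A"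
    and J: "J = {\<Oplus>\<^bsub>R\<^esub>i\<in>{..<n}. s i \<otimes>\<^bsub>R\<^esub> r i | s. s \<in> {..<n} \<rightarrow> carrier R}"
    using assms unfolding graded_finitely_generated_def by blast
  have "graded_variety G R A J = graded_variety G R A (r ` {..<n})"
    using graded_ideal_linear_combinations(2)[OF r J] graded_prime_imp_ideal
    by (auto simp: graded_variety_def graded_spectrum_def)
  then show ?thesis using r by (intro exI[of _ "r ` {..<n}"]) auto
qed

lemma finite_imp_graded_finitely_generated:
  assumes "finite F" "F \<subseteq> homogeneous G A"
  shows "\<exists>J. graded_ideal G R A J \<and> graded_finitely_generated G R A J \<and>
    graded_variety G R A J = graded_variety G R A F"
proof -
  obtain n :: nat and r where F: "F = r ` {..<n}"
    using finite_imp_nat_seg_image_inj_on[OF assms(1)] by (auto simp: lessThan_def)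
  have r: "r i \<in> homogeneous G A" if "i < n" for i using that assms(2) F by auto
  define J where "J = {\<Oplus>\<^bsub>R\<^esub>i\<in>{..<n}. s i \<otimes>\<^bsub>R\<^esub> r i | s. s \<in> {..<n} \<rightarrow> carrier R}"
  note J = graded_ideal_linear_combinations[OF r J_def]
  have "F \<subseteq> J" using J(2)[of J] J(1) F by (simp add: graded_ideal_def)
  then have "graded_finitely_generated G R A J"
    unfolding graded_finitely_generated_def using r F J_def by blast
  moreover have "graded_variety G R A J = graded_variety G R A F"
    using J(2) graded_prime_imp_ideal F by (auto simp: graded_variety_def graded_spectrum_def)
  ultimately show ?thesis using J(1) by blast
qed

text \<open>This turns the RFG property into one of varieties: \<open>J\<close> is traded for a
  finite set of homogeneous generators, and conversely such a set generates a suitable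
  \<open>J\<close>.\<close>

lemma RFG_ideal_iff:
  assumes "graded_ideal G R A I"
  shows "RFG_ideal G R A I \<longleftrightarrow>
    (\<exists>F. finite F \<and> F \<subseteq> homogeneous G A \<and> graded_variety G R A I = graded_variety G R A F)"
proof
  assume "RFG_ideal G R A I"
  then show "\<exists>F. finite F \<and> F \<subseteq> homogeneous G A \<and> graded_variety G R A I = graded_variety G R A F"
    unfolding RFG_ideal_def
    using graded_finitely_generated_imp_finite graded_radical_eq_iff by metis
next
  assume "\<exists>F. finite F \<and> F \<subseteq> homogeneous G A \<and> graded_variety G R A I = graded_variety G R A F"
  then obtain J where J: "graded_ideal G R A J" "graded_finitely_generated G R A J"
    "graded_variety G R A J = graded_variety G R A I"
    using finite_imp_graded_finitely_generated by metis
  then have "graded_radical G R A I = graded_radical G R A J"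
    using graded_radical_eq_iff[OF assms J(1)] by simp
  then show "RFG_ideal G R A I" unfolding RFG_ideal_def using assms J by blast
qed

text \<open>If some \<open>a\<close> in \<open>E\<close> lies outside the graded prime, primality
  forces all of \<open>F\<close> into it.\<close>

lemma graded_variety_products:
  assumes E: "E \<subseteq> homogeneous G A" and F: "F \<subseteq> homogeneous G A"
  shows "graded_variety G R A {a \<otimes>\<^bsub>R\<^esub> b | a b. a \<in> E \<and> b \<in> F} =
    graded_variety G R A E \<union> graded_variety G R A F"
proof -
  have "{a \<otimes>\<^bsub>R\<^esub> b | a b. a \<in> E \<and> b \<in> F} \<subseteq> p \<longleftrightarrow> E \<subseteq> p \<or> F \<subseteq> p"
    if p: "graded_prime_ideal G R A p" for p
  proof
    assume sub: "{a \<otimes>\<^bsub>R\<^esub> b | a b. a \<in> E \<and> b \<in> F} \<subseteq> p"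
    have "a \<in> p \<or> b \<in> p" if "a \<in> E" "b \<in> F" for a b
      using p E F sub that unfolding graded_prime_ideal_def by blast
    then show "E \<subseteq> p \<or> F \<subseteq> p" by blast
  next
    interpret p: ideal p R using p by (rule graded_prime_imp_ideal)
    have "E \<subseteq> carrier R" "F \<subseteq> carrier R" using E F homogeneous_carrier by auto
    then show "{a \<otimes>\<^bsub>R\<^esub> b | a b. a \<in> E \<and> b \<in> F} \<subseteq> p" if "E \<subseteq> p \<or> F \<subseteq> p"
      using that p.I_l_closed p.I_r_closed by blast
  qed
  then show ?thesis unfolding set_eq_iff Un_iff graded_variety_mem by blast
qed

text \<open>A compactness property, by induction on \<open>F\<close>: for each element of
  \<open>F\<close> some power lies in the union, hence in one member of the chain, and of two
  members the larger serves both purposes.\<close>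

lemma graded_variety_chain_compact:
  assumes \<C>: "\<C> \<noteq> {}" "subset.chain {I. graded_ideal G R A I} \<C>"
    and F: "finite F" "F \<subseteq> homogeneous G A"
    and sub: "graded_variety G R A (\<Union>\<C>) \<subseteq> graded_variety G R A F"
  shows "\<exists>I\<in>\<C>. graded_variety G R A I \<subseteq> graded_variety G R A F"
  using F sub
proof (induction F)
  case empty
  then show ?case using \<C>(1) graded_variety_empty_set by (auto simp: graded_variety_def)
next
  case (insert x F)
  have ins: "graded_variety G R A (insert x F) = graded_variety G R A {x} \<inter> graded_variety G R A F"
    using graded_variety_Un[of "{x}" F] by simp
  then obtain I where I: "I \<in> \<C>" "graded_variety G R A I \<subseteq> graded_variety G R A F"
    using insert by auto
  have x: "x \<in> homogeneous G A" using insert.prems by simp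
  have "\<forall>p\<in>graded_variety G R A (\<Union>\<C>). x \<in> p"
    using insert.prems by (auto simp: graded_variety_mem)
  \<comment> \<open>The Nullstellensatz puts a power of \<open>x\<close> into the union of \<C>;
    \<open>K\<close> is a member containing that power.\<close>
  then obtain n :: nat and K where K: "n > 0" "K \<in> \<C>" "x [^]\<^bsub>R\<^esub> n \<in> K"
    using homogeneous_power_mem_iff[OF graded_ideal_chain_Union[OF \<C>] x] by blast
  then have "graded_variety G R A K \<subseteq> graded_variety G R A {x}"
    using graded_prime_pow_mem[OF _ x K(1)] K(3) unfolding subset_iff graded_variety_mem by simp
  moreover have "I \<subseteq> K \<or> K \<subseteq> I" using \<C>(2) I(1) K(2) by (auto simp: subset.chain_def)
  ultimately show ?case
    using I K(2) graded_variety_antimono[of I K] graded_variety_antimono[of K I] ins by blast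
qed

section \<open>From graded primes to all graded ideals\<close>

text \<open>The finitely many nonzero components of 1 cannot all lie in a proper ideal, so they cut
  out the empty variety.\<close>

lemma RFG_ideal_carrier: "RFG_ideal G R A (carrier R)"
proof -
  define F where "F = (\<lambda>g. component g \<one>\<^bsub>R\<^esub>) ` {g \<in> carrier G. component g \<one>\<^bsub>R\<^esub> \<noteq> \<zero>\<^bsub>R\<^esub>}"
  have F: "finite F" "F \<subseteq> homogeneous G A"
    using finite_component_support[OF R.one_closed] component_homogeneous[OF R.one_closed]
    by (auto simp: F_def)
  have "\<not> F \<subseteq> p" if p: "graded_prime_ideal G R A p" for p
  proof
    assume sub: "F \<subseteq> p"
    interpret p: ideal p R using p by (rule graded_prime_imp_ideal)
    have "component g \<one>\<^bsub>R\<^esub> \<in> p" if "g \<in> carrier G" for g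
      using sub p.zero_closed that by (cases "component g \<one>\<^bsub>R\<^esub> = \<zero>\<^bsub>R\<^esub>") (auto simp: F_def)
    then have "\<one>\<^bsub>R\<^esub> \<in> p" by (rule mem_ideal_if_components[OF p.is_ideal R.one_closed])
    then show False using p.one_imp_carrier p by (simp add: graded_prime_ideal_def)
  qed
  then have "graded_variety G R A F = {}" by (auto simp: graded_variety_mem)
  then show ?thesis
    using F graded_variety_carrier by (auto simp: RFG_ideal_iff[OF graded_ideal_carrier])
qed

text \<open>With \<F> as the RFG property, the prime ideal principle would place a graded ideal that
  is not RFG inside a graded prime that is not RFG.\<close>

lemma RFG_ideal_if_primes:
  assumes primes: "\<And>p. graded_prime_ideal G R A p \<Longrightarrow> RFG_ideal G R A p"
    and J: "graded_ideal G R A J"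
  shows "RFG_ideal G R A J"
proof (rule ccontr)
  assume "\<not> RFG_ideal G R A J"
  with J have "\<exists>p. graded_prime_ideal G R A p \<and> J \<subseteq> p \<and> \<not> RFG_ideal G R A p"
  proof (rule graded_prime_ideal_principle[where \<F> = "RFG_ideal G R A", rotated 3])
    show "RFG_ideal G R A (carrier R)" by (rule RFG_ideal_carrier)
  next
    fix I a b
    assume I: "graded_ideal G R A I" and a: "a \<in> homogeneous G A" and b: "b \<in> homogeneous G A"
      and ab: "a \<otimes>\<^bsub>R\<^esub> b \<in> I" and "RFG_ideal G R A (graded_span (insert a I))"
      and "RFG_ideal G R A (graded_span (insert b I))"
    moreover have "graded_ideal G R A (graded_span (insert c I))" if "c \<in> homogeneous G A" for c
      using that graded_ideal_subset[OF I] homogeneous_carrier by (intro graded_ideal_span) auto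
    ultimately obtain E F where E: "finite E" "E \<subseteq> homogeneous G A"
        "graded_variety G R A (insert a I) = graded_variety G R A E"
      and F: "finite F" "F \<subseteq> homogeneous G A"
        "graded_variety G R A (insert b I) = graded_variety G R A F"
      using RFG_ideal_iff graded_variety_span by metis
    \<comment> \<open>As \<open>a \<otimes> b\<close> is in \<open>I\<close>, every graded prime
      above \<open>I\<close> contains \<open>a\<close> or \<open>b\<close>. The two parts are cut
      out by \<open>E\<close> and \<open>F\<close>, so their union is cut out by the finite set of
      products.\<close>
    have "graded_variety G R A I = graded_variety G R A (insert a I) \<union> graded_variety G R A (insert b I)"
    proof -
      have "a \<in> p \<or> b \<in> p" if "graded_prime_ideal G R A p" "I \<subseteq> p" for p
        using that a b ab by (auto simp only: graded_prime_ideal_def)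
      then show ?thesis
        unfolding set_eq_iff Un_iff graded_variety_mem insert_subset by blast
    qed
    also have "\<dots> = graded_variety G R A {x \<otimes>\<^bsub>R\<^esub> y | x y. x \<in> E \<and> y \<in> F}"
      using graded_variety_products E F by simp
    finally have "graded_variety G R A I = graded_variety G R A {x \<otimes>\<^bsub>R\<^esub> y | x y. x \<in> E \<and> y \<in> F}" .
    moreover have "finite {x \<otimes>\<^bsub>R\<^esub> y | x y. x \<in> E \<and> y \<in> F}"
      using E(1) F(1) by (intro finite_image_set2) auto
    moreover have "{x \<otimes>\<^bsub>R\<^esub> y | x y. x \<in> E \<and> y \<in> F} \<subseteq> homogeneous G A"
      using E(2) F(2) homogeneous_mult by blast
    ultimately show "RFG_ideal G R A I" using RFG_ideal_iff[OF I] by blast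
  next
    fix \<C> assume \<C>: "\<C> \<noteq> {}" "subset.chain {I. graded_ideal G R A I} \<C>" "RFG_ideal G R A (\<Union>\<C>)"
    then obtain F where F: "finite F" "F \<subseteq> homogeneous G A"
      "graded_variety G R A (\<Union>\<C>) = graded_variety G R A F"
      using RFG_ideal_iff[OF graded_ideal_chain_Union] by blast
    then obtain I where I: "I \<in> \<C>" "graded_variety G R A I \<subseteq> graded_variety G R A F"
      using graded_variety_chain_compact[OF \<C>(1,2)] by blast
    \<comment> \<open>The variety of \<open>I\<close> is squeezed: it contains that of the larger
      ideal, the union, which equals the variety of \<open>F\<close>.\<close>
    then have "graded_variety G R A I = graded_variety G R A F"
      using F(3) graded_variety_antimono[of I "\<Union>\<C>"] by blast
    moreover have "graded_ideal G R A I" using \<C>(2) I(1) by (auto simp: subset.chain_def)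
    ultimately show "\<exists>I\<in>\<C>. RFG_ideal G R A I" using F I(1) RFG_ideal_iff by blast
  qed
  then show False using primes by blast
qed

section \<open>RFG ideals and the Noetherian property\<close>

text \<open>A descending chain of closed sets becomes an ascending chain of radical ideals. Its
  union has the variety of a finite set, and by compactness one member of the chain already reaches
  it.\<close>

lemma noetherian_if_RFG:
  assumes RFG: "\<And>I. graded_ideal G R A I \<Longrightarrow> RFG_ideal G R A I"
  shows "noetherian_space (zariski_topology G R A)"
  unfolding noetherian_space_def
proof (intro allI impI, elim conjE)
  fix C :: "nat \<Rightarrow> 'a set set"
  assume "\<forall>n. closedin (zariski_topology G R A) (C n)" and dec: "\<forall>n. C (Suc n) \<subseteq> C n"
  then have "\<forall>n. \<exists>J. graded_ideal G R A J \<and> C n = graded_variety G R A J"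
    by (simp add: closedin_zariski)
  then obtain J where J: "\<And>n. graded_ideal G R A (J n)" "\<And>n. C n = graded_variety G R A (J n)"
    by metis
  \<comment> \<open>The chosen \<open>J n\<close> need not be nested. Their radicals are, and they
    have the same varieties.\<close>
  define I where "I n = graded_radical G R A (J n)" for n
  have I: "graded_ideal G R A (I n)" "graded_variety G R A (I n) = C n" for n
    using J graded_ideal_radical graded_variety_radical by (simp_all add: I_def)
  have "I n \<subseteq> I (Suc n)" for n
    unfolding I_def graded_radical_eq[OF J(1)] J(2)[symmetric] using dec by blast
  then have mono: "mono I" by (simp add: mono_iff_le_Suc)
  then have chain: "range I \<noteq> {}" "subset.chain {I. graded_ideal G R A I} (range I)"
    using I(1) monoD[OF mono] nat_le_linear by (auto simp only: subset.chain_def) blast+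
  obtain F where F: "finite F" "F \<subseteq> homogeneous G A"
    "graded_variety G R A (\<Union>(range I)) = graded_variety G R A F"
    using RFG[OF graded_ideal_chain_Union[OF chain]]
      RFG_ideal_iff[OF graded_ideal_chain_Union[OF chain]] by blast
  then obtain n where n: "C n \<subseteq> graded_variety G R A F"
    using graded_variety_chain_compact[OF chain, of F] I(2) by auto
  have "C m = C n" if "m \<ge> n" for m
  proof
    show "C m \<subseteq> C n" using graded_variety_antimono[OF monoD[OF mono that]] I(2) by simp
    have "graded_variety G R A (\<Union>(range I)) \<subseteq> C m"
      using graded_variety_antimono[of "I m" "\<Union>(range I)"] I(2) by auto
    then show "C n \<subseteq> C m" using n F(3) by simp
  qed
  then show "\<exists>n. \<forall>m\<ge>n. C m = C n" by blast
qed

text \<open>Among the varieties of finite sets of homogeneous elements of \<open>I\<close> a minimal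
  one exists, and minimality makes it the variety of \<open>I\<close>.\<close>

lemma RFG_if_noetherian:
  assumes noeth: "noetherian_space (zariski_topology G R A)"
    and I: "graded_ideal G R A I"
  shows "RFG_ideal G R A I"
proof -
  define P where "P F \<longleftrightarrow> finite F \<and> F \<subseteq> I \<inter> homogeneous G A" for F
  have "\<exists>F. P F \<and> (\<forall>E. P E \<longrightarrow> \<not> graded_variety G R A E \<subset> graded_variety G R A F)"
  proof (rule ccontr)
    assume none: "\<not> ?thesis"
    \<comment> \<open>Without a minimal variety, dependent choice yields a strictly descending
      sequence.\<close>
    have "\<exists>f. \<forall>n::nat. P (f n) \<and> graded_variety G R A (f (Suc n)) \<subset> graded_variety G R A (f n)"
      by (rule dependent_nat_choice) (use none in \<open>auto simp: P_def\<close>)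
    then obtain f :: "nat \<Rightarrow> 'a set" where f: "\<And>n. P (f n)"
      "\<And>n. graded_variety G R A (f (Suc n)) \<subset> graded_variety G R A (f n)"
      by blast
    \<comment> \<open>\<open>f n\<close> is only a finite set; its variety is closed because it is
      also that of the graded ideal generated by \<open>f n\<close>.\<close>
    have "closedin (zariski_topology G R A) (graded_variety G R A (f n))" for n
      using finite_imp_graded_finitely_generated[of "f n"] f(1)[of n]
      unfolding closedin_zariski P_def by force
    then obtain n where "\<forall>m\<ge>n. graded_variety G R A (f m) = graded_variety G R A (f n)"
      using noeth[unfolded noetherian_space_def, rule_format, of "\<lambda>n. graded_variety G R A (f n)"]
        f(2) by blast
    then show False using f(2)[of n] by (metis le_Suc_eq order_refl psubset_eq)
  qed
  then obtain F where F: "P F"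
    "\<And>E. P E \<Longrightarrow> \<not> graded_variety G R A E \<subset> graded_variety G R A F"
    by blast
  have "I \<subseteq> q" if q: "q \<in> graded_variety G R A F" for q
  proof (rule ccontr)
    assume "\<not> I \<subseteq> q"
    \<comment> \<open>Adding such an \<open>a\<close> to \<open>F\<close> removes \<open>q\<close>
      from the variety, against minimality.\<close>
    then obtain a where a: "a \<in> I \<inter> homogeneous G A" "a \<notin> q"
      using homogeneous_not_mem[OF I graded_prime_imp_ideal] q by (auto simp: graded_variety_mem)
    then have "P (insert a F)" using F(1) by (simp add: P_def)
    moreover have "graded_variety G R A (insert a F) \<subset> graded_variety G R A F"
      using q a(2) by (auto simp: graded_variety_mem)
    ultimately show False using F(2) by blast
  qed
  then have "graded_variety G R A F \<subseteq> graded_variety G R A I"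
    by (auto simp: graded_variety_mem)
  moreover have "graded_variety G R A I \<subseteq> graded_variety G R A F"
    using F(1) by (intro graded_variety_antimono) (simp add: P_def)
  ultimately have "graded_variety G R A I = graded_variety G R A F" by blast
  then show ?thesis using F(1) RFG_ideal_iff[OF I] by (auto simp: P_def)
qed

end

theorem corollary2p13:
  fixes G :: "('g, 'n) monoid_scheme"
    and R :: "('a, 'm) ring_scheme"
    and A :: "'g \<Rightarrow> 'a set"
  assumes "graded_cring G R A"
  shows "noetherian_space (zariski_topology G R A) \<longleftrightarrow>
    (\<forall>p. graded_prime_ideal G R A p \<longrightarrow> RFG_ideal G R A p)"
proof -
  interpret graded_cring G R A by fact
  show ?thesis
    using RFG_if_noetherian graded_prime_imp_graded noetherian_if_RFG RFG_ideal_if_primes by blast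
qed

end
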